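(* Let $\mathcal C$ be a prenormal category, and consider a pullback square in $\mathcal C$ formed by morphisms $f'\colon X'\to Y'$, $x\colon X'\to X$, $y\colon Y'\to Y$, $f\colon X\to Y$ with $y\circ f'=f\circ x$ (so $f'$ is the pullback of $f$ along $y$, and $x$ is the pullback of $y$ along $f$). This square is also a pushout whenever one of the following conditions holds: (a) $f$ is a normal epimorphism; (b) $x$ is a normal epimorphism, $f$ is a regular epimorphism, and $f'$ is an epimorphism.
   Context: A pointed category is a category with a zero object. In a pointed category, a normal epimorphism is a morphism that is a cokernel of some morphism. A prenormal category is a pointed category $\mathcal C$ such that: (1) $\mathcal C$ has finite limits; (2) $\mathcal C$ has cokernels of kernels (every morphism which is a kernel has a cokernel); (3) normal epimorphisms are pullback-stable in $\mathcal C$ (the pullback of a normal epimorphism along any morphism is a normal epimorphism). *)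

theory Defs
  imports Main
begin

record ('o, 'm) cat =
  Obj :: "'o set"
  Arr :: "'m set"
  Dom :: "'m \<Rightarrow> 'o"
  Cod :: "'m \<Rightarrow> 'o"
  Id :: "'o \<Rightarrow> 'm"
  Comp :: "'m \<Rightarrow> 'm \<Rightarrow> 'm"  (infixl "\<odot>\<index>" 70)

text \<open>Composition is written in the usual order: \<open>g \<odot>\<^bsub>C\<^esub> f\<close> is ``\<open>g\<close> after \<open>f\<close>''.
  The operations of the record are only meaningful on \<open>Obj\<close>, \<open>Arr\<close> and composable pairs.\<close>

definition Hom :: "('o, 'm) cat \<Rightarrow> 'o \<Rightarrow> 'o \<Rightarrow> 'm set" where
  "Hom C a b = {f \<in> Arr C. Dom C f = a \<and> Cod C f = b}"

locale category =
  fixes C :: "('o, 'm) cat" (structure)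
  assumes dom_obj: "f \<in> Arr C \<Longrightarrow> Dom C f \<in> Obj C"
    and cod_obj: "f \<in> Arr C \<Longrightarrow> Cod C f \<in> Obj C"
    and id_hom: "a \<in> Obj C \<Longrightarrow> Id C a \<in> Hom C a a"
    and comp_hom: "f \<in> Hom C a b \<Longrightarrow> g \<in> Hom C b c \<Longrightarrow> g \<odot> f \<in> Hom C a c"
    and id_left: "f \<in> Hom C a b \<Longrightarrow> Id C b \<odot> f = f"
    and id_right: "f \<in> Hom C a b \<Longrightarrow> f \<odot> Id C a = f"
    and comp_assoc: "f \<in> Hom C a b \<Longrightarrow> g \<in> Hom C b c \<Longrightarrow> h \<in> Hom C c d \<Longrightarrow>
      (h \<odot> g) \<odot> f = h \<odot> (g \<odot> f)"

definition is_functor ::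
  "('i, 'j) cat \<Rightarrow> ('o, 'm) cat \<Rightarrow> ('i \<Rightarrow> 'o) \<Rightarrow> ('j \<Rightarrow> 'm) \<Rightarrow> bool" where
  "is_functor J C F0 F1 \<longleftrightarrow>
     (\<forall>i\<in>Obj J. F0 i \<in> Obj C) \<and>
     (\<forall>i\<in>Obj J. \<forall>j\<in>Obj J. \<forall>\<alpha>\<in>Hom J i j. F1 \<alpha> \<in> Hom C (F0 i) (F0 j)) \<and>
     (\<forall>i\<in>Obj J. F1 (Id J i) = Id C (F0 i)) \<and>
     (\<forall>i\<in>Obj J. \<forall>j\<in>Obj J. \<forall>k\<in>Obj J. \<forall>\<alpha>\<in>Hom J i j. \<forall>\<beta>\<in>Hom J j k.
        F1 (\<beta> \<odot>\<^bsub>J\<^esub> \<alpha>) = F1 \<beta> \<odot>\<^bsub>C\<^esub> F1 \<alpha>)"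

definition is_cone ::
  "('i, 'j) cat \<Rightarrow> ('o, 'm) cat \<Rightarrow> ('i \<Rightarrow> 'o) \<Rightarrow> ('j \<Rightarrow> 'm) \<Rightarrow> 'o \<Rightarrow> ('i \<Rightarrow> 'm) \<Rightarrow> bool" where
  "is_cone J C F0 F1 a \<pi> \<longleftrightarrow>
     a \<in> Obj C \<and>
     (\<forall>i\<in>Obj J. \<pi> i \<in> Hom C a (F0 i)) \<and>
     (\<forall>i\<in>Obj J. \<forall>j\<in>Obj J. \<forall>\<alpha>\<in>Hom J i j. F1 \<alpha> \<odot>\<^bsub>C\<^esub> \<pi> i = \<pi> j)"

definition is_limit ::
  "('i, 'j) cat \<Rightarrow> ('o, 'm) cat \<Rightarrow> ('i \<Rightarrow> 'o) \<Rightarrow> ('j \<Rightarrow> 'm) \<Rightarrow> 'o \<Rightarrow> ('i \<Rightarrow> 'm) \<Rightarrow> bool" where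
  "is_limit J C F0 F1 a \<pi> \<longleftrightarrow>
     is_cone J C F0 F1 a \<pi> \<and>
     (\<forall>b \<rho>. is_cone J C F0 F1 b \<rho> \<longrightarrow>
        (\<exists>!h. h \<in> Hom C b a \<and> (\<forall>i\<in>Obj J. \<pi> i \<odot>\<^bsub>C\<^esub> h = \<rho> i)))"

text \<open>HOL formulas cannot quantify over types, so the index categories are taken with objects and
  arrows in \<open>nat\<close>. This loses nothing: every finite category is isomorphic to one of these.\<close>

definition has_finite_limits :: "('o, 'm) cat \<Rightarrow> bool" where
  "has_finite_limits C \<longleftrightarrow>
     (\<forall>(J :: (nat, nat) cat) F0 F1.
        category J \<and> finite (Obj J) \<and> finite (Arr J) \<and> is_functor J C F0 F1 \<longrightarrow>
        (\<exists>a \<pi>. is_limit J C F0 F1 a \<pi>))"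

definition epi :: "('o, 'm) cat \<Rightarrow> 'm \<Rightarrow> bool" where
  "epi C e \<longleftrightarrow> e \<in> Arr C \<and>
     (\<forall>z. \<forall>g\<in>Hom C (Cod C e) z. \<forall>h\<in>Hom C (Cod C e) z.
        g \<odot>\<^bsub>C\<^esub> e = h \<odot>\<^bsub>C\<^esub> e \<longrightarrow> g = h)"

definition is_coequalizer :: "('o, 'm) cat \<Rightarrow> 'm \<Rightarrow> 'm \<Rightarrow> 'm \<Rightarrow> bool" where
  "is_coequalizer C s t q \<longleftrightarrow>
     s \<in> Arr C \<and> t \<in> Hom C (Dom C s) (Cod C s) \<and>
     q \<in> Arr C \<and> Dom C q = Cod C s \<and> q \<odot>\<^bsub>C\<^esub> s = q \<odot>\<^bsub>C\<^esub> t \<and>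
     (\<forall>z. \<forall>g\<in>Hom C (Cod C s) z. g \<odot>\<^bsub>C\<^esub> s = g \<odot>\<^bsub>C\<^esub> t \<longrightarrow>
        (\<exists>!h. h \<in> Hom C (Cod C q) z \<and> h \<odot>\<^bsub>C\<^esub> q = g))"

definition regular_epi :: "('o, 'm) cat \<Rightarrow> 'm \<Rightarrow> bool" where
  "regular_epi C q \<longleftrightarrow> (\<exists>s t. is_coequalizer C s t q)"

definition zero_object :: "('o, 'm) cat \<Rightarrow> 'o \<Rightarrow> bool" where
  "zero_object C z \<longleftrightarrow> z \<in> Obj C \<and>
     (\<forall>a\<in>Obj C. \<exists>!f. f \<in> Hom C z a) \<and> (\<forall>a\<in>Obj C. \<exists>!f. f \<in> Hom C a z)"

definition zero_arrow :: "('o, 'm) cat \<Rightarrow> 'm \<Rightarrow> bool" where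
  "zero_arrow C f \<longleftrightarrow> f \<in> Arr C \<and>
     (\<exists>z. zero_object C z \<and>
        (\<exists>p\<in>Hom C (Dom C f) z. \<exists>i\<in>Hom C z (Cod C f). f = i \<odot>\<^bsub>C\<^esub> p))"

text \<open>In the next two definitions the last argument is the (co)kernel arrow, the one before it the
  arrow it is a (co)kernel of.\<close>

definition is_kernel :: "('o, 'm) cat \<Rightarrow> 'm \<Rightarrow> 'm \<Rightarrow> bool" where
  "is_kernel C f k \<longleftrightarrow>
     f \<in> Arr C \<and> k \<in> Arr C \<and> Cod C k = Dom C f \<and> zero_arrow C (f \<odot>\<^bsub>C\<^esub> k) \<and>
     (\<forall>z. \<forall>g\<in>Hom C z (Dom C f). zero_arrow C (f \<odot>\<^bsub>C\<^esub> g) \<longrightarrow>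
        (\<exists>!h. h \<in> Hom C z (Dom C k) \<and> k \<odot>\<^bsub>C\<^esub> h = g))"

definition is_cokernel :: "('o, 'm) cat \<Rightarrow> 'm \<Rightarrow> 'm \<Rightarrow> bool" where
  "is_cokernel C f q \<longleftrightarrow>
     f \<in> Arr C \<and> q \<in> Arr C \<and> Dom C q = Cod C f \<and> zero_arrow C (q \<odot>\<^bsub>C\<^esub> f) \<and>
     (\<forall>z. \<forall>g\<in>Hom C (Cod C f) z. zero_arrow C (g \<odot>\<^bsub>C\<^esub> f) \<longrightarrow>
        (\<exists>!h. h \<in> Hom C (Cod C q) z \<and> h \<odot>\<^bsub>C\<^esub> q = g))"

definition normal_epi :: "('o, 'm) cat \<Rightarrow> 'm \<Rightarrow> bool" where
  "normal_epi C q \<longleftrightarrow> (\<exists>f. is_cokernel C f q)"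

text \<open>For all three predicates below, the arguments \<open>f' x y f\<close> are the sides of the square
\begin{verbatim}
        f'
    X' ---> Y'
    |       |
  x |       | y
    v       v
    X  ---> Y
        f
\end{verbatim}
\<close>

definition commutative_square :: "('o, 'm) cat \<Rightarrow> 'm \<Rightarrow> 'm \<Rightarrow> 'm \<Rightarrow> 'm \<Rightarrow> bool" where
  "commutative_square C f' x y f \<longleftrightarrow>
     f' \<in> Arr C \<and> x \<in> Arr C \<and> y \<in> Arr C \<and> f \<in> Arr C \<and>
     Dom C f' = Dom C x \<and> Cod C f' = Dom C y \<and> Cod C x = Dom C f \<and> Cod C y = Cod C f \<and>
     y \<odot>\<^bsub>C\<^esub> f' = f \<odot>\<^bsub>C\<^esub> x"

definition is_pullback :: "('o, 'm) cat \<Rightarrow> 'm \<Rightarrow> 'm \<Rightarrow> 'm \<Rightarrow> 'm \<Rightarrow> bool" where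
  "is_pullback C f' x y f \<longleftrightarrow>
     commutative_square C f' x y f \<and>
     (\<forall>z. \<forall>u\<in>Hom C z (Dom C y). \<forall>v\<in>Hom C z (Dom C f). y \<odot>\<^bsub>C\<^esub> u = f \<odot>\<^bsub>C\<^esub> v \<longrightarrow>
        (\<exists>!h. h \<in> Hom C z (Dom C x) \<and> f' \<odot>\<^bsub>C\<^esub> h = u \<and> x \<odot>\<^bsub>C\<^esub> h = v))"

definition is_pushout :: "('o, 'm) cat \<Rightarrow> 'm \<Rightarrow> 'm \<Rightarrow> 'm \<Rightarrow> 'm \<Rightarrow> bool" where
  "is_pushout C f' x y f \<longleftrightarrow>
     commutative_square C f' x y f \<and>
     (\<forall>z. \<forall>u\<in>Hom C (Cod C f') z. \<forall>v\<in>Hom C (Cod C x) z. u \<odot>\<^bsub>C\<^esub> f' = v \<odot>\<^bsub>C\<^esub> x \<longrightarrow>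
        (\<exists>!h. h \<in> Hom C (Cod C f) z \<and> h \<odot>\<^bsub>C\<^esub> y = u \<and> h \<odot>\<^bsub>C\<^esub> f = v))"

locale pointed_category = category C for C :: "('o, 'm) cat" (structure) +
  assumes ex_zero_object: "\<exists>z. zero_object C z"

locale prenormal_category = pointed_category C for C :: "('o, 'm) cat" (structure) +
  assumes finite_limits: "has_finite_limits C"
    and cokernels_of_kernels: "(\<exists>f. is_kernel C f k) \<Longrightarrow> \<exists>q. is_cokernel C k q"
    and normal_epi_pullback_stable:
      "is_pullback C f' x y f \<Longrightarrow> normal_epi C f \<Longrightarrow> normal_epi C f'"

end

theory Submission
  imports Defs
begin

text \<open>
  To prove that a commutative square with \<open>f\<close> a coequalizer or cokernel and \<open>f'\<close> an epimorphism is
  a pushout, it is enough to know that every arrow \<open>v\<close> out of \<open>X\<close> with \<open>u f' = v x\<close> for some \<open>u\<close>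
  factors through \<open>f\<close>: a factorization \<open>v = h f\<close> also satisfies \<open>h y f' = h f x = v x = u f'\<close>, and
  cancelling \<open>f'\<close> gives \<open>h y = u\<close> (lemma \<open>pushout_if_factors\<close>). Uniqueness of \<open>h\<close> is clear because \<open>f\<close>
  is an epimorphism.

  In case (a), \<open>f\<close> is a cokernel of some \<open>g\<close>. The pair \<open>(0, g)\<close> is compatible with the pullback, so
  \<open>g = x g'\<close> with \<open>f' g' = 0\<close>. Then \<open>v g = v x g' = u f' g' = 0\<close>, so \<open>v\<close> factors through \<open>f\<close>. The
  arrow \<open>f'\<close> is an epimorphism because normal epimorphisms are pullback-stable.

  In case (b), \<open>f\<close> is a coequalizer of some \<open>s\<close>, \<open>t\<close>. Neither lifts along \<open>x\<close> in general, but \<open>s\<close> does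
  after precomposition with the pullback \<open>p\<close> of \<open>x\<close> along \<open>s\<close>: \<open>s p = x a\<close>. As
  \<open>f t p = f s p = f x a = y f' a\<close>, the pullback then provides \<open>b\<close> with \<open>t p = x b\<close> and
  \<open>f' b = f' a\<close>. Hence \<open>v s p = u f' a = u f' b = v t p\<close>. Here \<open>p\<close> is again a normal epimorphism, so
  it can be cancelled, and \<open>v\<close> coequalizes \<open>s\<close> and \<open>t\<close>.
\<close>

section \<open>Epimorphisms, zero arrows and a pushout criterion\<close>

lemma HomI: "f \<in> Arr C \<Longrightarrow> Dom C f = a \<Longrightarrow> Cod C f = b \<Longrightarrow> f \<in> Hom C a b"
  by (simp add: Hom_def)

lemma HomD:
  assumes "f \<in> Hom C a b"
  shows "f \<in> Arr C" "Dom C f = a" "Cod C f = b"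
  using assms by (auto simp: Hom_def)

context category
begin

lemma Hom_objs:
  assumes "f \<in> Hom C a b"
  shows "a \<in> Obj C" "b \<in> Obj C"
  using assms dom_obj cod_obj by (auto simp: Hom_def)

lemma is_pullbackD:
  assumes "is_pullback C f' x y f"
    and "f' \<in> Hom C X' Y'" "x \<in> Hom C X' X" "y \<in> Hom C Y' Y" "f \<in> Hom C X Y"
    and "u \<in> Hom C z Y'" "v \<in> Hom C z X" "y \<odot> u = f \<odot> v"
  shows "\<exists>h\<in>Hom C z X'. f' \<odot> h = u \<and> x \<odot> h = v"
proof -
  have "\<exists>!h. h \<in> Hom C z X' \<and> f' \<odot> h = u \<and> x \<odot> h = v"
    using assms by (simp add: is_pullback_def HomD[OF assms(3)] HomD[OF assms(4)] HomD[OF assms(5)])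
  then show ?thesis
    by blast
qed

lemma epiD:
  assumes "epi C e" "e \<in> Hom C a b" "g \<in> Hom C b z" "h \<in> Hom C b z" "g \<odot> e = h \<odot> e"
  shows "g = h"
  using assms by (auto simp: epi_def HomD(3)[OF assms(2)])

lemma pushout_if_factors:
  assumes f': "f' \<in> Hom C X' Y'" and x: "x \<in> Hom C X' X"
    and y: "y \<in> Hom C Y' Y" and f: "f \<in> Hom C X Y"
    and comm: "y \<odot> f' = f \<odot> x"
    and epis: "epi C f'" "epi C f"
    and factors: "\<And>z u v. u \<in> Hom C Y' z \<Longrightarrow> v \<in> Hom C X z \<Longrightarrow> u \<odot> f' = v \<odot> x \<Longrightarrow>
      \<exists>h\<in>Hom C Y z. h \<odot> f = v"
  shows "is_pushout C f' x y f"
proof -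
  have "\<exists>!h. h \<in> Hom C Y z \<and> h \<odot> y = u \<and> h \<odot> f = v"
    if u: "u \<in> Hom C Y' z" and v: "v \<in> Hom C X z" and uv: "u \<odot> f' = v \<odot> x" for z u v
  proof -
    obtain h where h: "h \<in> Hom C Y z" "h \<odot> f = v"
      using factors[OF u v uv] by blast
    have "(h \<odot> y) \<odot> f' = h \<odot> (f \<odot> x)"
      using comp_assoc[OF f' y h(1)] comm by simp
    also have "\<dots> = u \<odot> f'"
      using comp_assoc[OF x f h(1)] h(2) uv by simp
    finally have "h \<odot> y = u"
      using epiD[OF epis(1) f' comp_hom[OF y h(1)] u] by blast
    moreover have "h' = h" if "h' \<in> Hom C Y z" "h' \<odot> f = v" for h'
      using epiD[OF epis(2) f that(1) h(1)] that(2) h(2) by simp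
    ultimately show ?thesis
      using h by blast
  qed
  then show ?thesis
    using f' x y f comm
    by (auto simp: is_pushout_def commutative_square_def HomD[OF f'] HomD[OF x] HomD[OF y] HomD[OF f])
qed

lemma coequalizer_epi:
  assumes "is_coequalizer C s t q"
  shows "epi C q"
proof -
  define A B where "A = Dom C s" and "B = Cod C s"
  have s: "s \<in> Hom C A B" and t: "t \<in> Hom C A B" and q: "q \<in> Hom C B (Cod C q)"
    and qst: "q \<odot> s = q \<odot> t"
    using assms by (auto simp: is_coequalizer_def A_def B_def intro!: HomI)
  have "g = h"
    if g: "g \<in> Hom C (Cod C q) z" and h: "h \<in> Hom C (Cod C q) z" and gh: "g \<odot> q = h \<odot> q" for z g h
  proof -
    have "(h \<odot> q) \<odot> s = (h \<odot> q) \<odot> t"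
      using comp_assoc[OF s q h] comp_assoc[OF t q h] qst by simp
    then have "\<exists>!k. k \<in> Hom C (Cod C q) z \<and> k \<odot> q = h \<odot> q"
      using assms comp_hom[OF q h] by (auto simp: is_coequalizer_def B_def)
    then show ?thesis
      using g h gh by blast
  qed
  then show ?thesis
    using HomD(1)[OF q] by (auto simp: epi_def)
qed

lemma zero_arrowE:
  assumes "zero_arrow C f" "f \<in> Hom C a b"
  obtains z p i where "zero_object C z" "p \<in> Hom C a z" "i \<in> Hom C z b" "f = i \<odot> p"
  using assms by (auto simp: zero_arrow_def HomD[OF assms(2)])

lemma zero_arrowI:
  assumes "zero_object C z" "p \<in> Hom C a z" "i \<in> Hom C z b"
  shows "zero_arrow C (i \<odot> p)"
  using assms HomD[OF comp_hom[OF assms(2,3)]] by (auto simp: zero_arrow_def)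

lemma comp_zero_arrow_right:
  assumes f: "f \<in> Hom C a b" and g: "g \<in> Hom C b c" and "zero_arrow C f"
  shows "zero_arrow C (g \<odot> f)"
proof -
  obtain z p i where z: "zero_object C z"
    and p: "p \<in> Hom C a z" and i: "i \<in> Hom C z b" and fip: "f = i \<odot> p"
    using zero_arrowE[OF assms(3) f] .
  have "g \<odot> f = (g \<odot> i) \<odot> p"
    using comp_assoc[OF p i g] fip by simp
  then show ?thesis
    using zero_arrowI[OF z p comp_hom[OF i g]] by simp
qed

text \<open>The factorizations may pass through different zero objects; they are compared along the
  unique arrow \<open>c\<close> between these objects.\<close>

lemma zero_arrow_unique:
  assumes f: "f \<in> Hom C a b" and g: "g \<in> Hom C a b"
    and "zero_arrow C f" "zero_arrow C g"
  shows "f = g"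
proof -
  obtain z p i where z: "zero_object C z"
    and p: "p \<in> Hom C a z" and i: "i \<in> Hom C z b" and fip: "f = i \<odot> p"
    using zero_arrowE[OF assms(3) f] .
  obtain z' p' i' where z': "zero_object C z'"
    and p': "p' \<in> Hom C a z'" and i': "i' \<in> Hom C z' b" and gip: "g = i' \<odot> p'"
    using zero_arrowE[OF assms(4) g] .
  obtain c where c: "c \<in> Hom C z z'"
    using z z' by (meson zero_object_def)
  have "\<exists>!k. k \<in> Hom C a z'"
    using z' Hom_objs(1)[OF f] by (simp add: zero_object_def)
  then have "c \<odot> p = p'"
    using comp_hom[OF p c] p' by blast
  moreover have "\<exists>!k. k \<in> Hom C z b"
    using z Hom_objs(2)[OF f] by (simp add: zero_object_def)
  then have "i' \<odot> c = i"
    using comp_hom[OF c i'] i by blast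
  ultimately show ?thesis
    using fip gip comp_assoc[OF p c i'] by simp
qed

lemma normal_epi_imp_epi:
  assumes "normal_epi C q"
  shows "epi C q"
proof -
  obtain f where q_coker: "is_cokernel C f q"
    using assms by (auto simp: normal_epi_def)
  then have f: "f \<in> Hom C (Dom C f) (Cod C f)" and q: "q \<in> Hom C (Cod C f) (Cod C q)"
    and zero: "zero_arrow C (q \<odot> f)"
    by (auto simp: is_cokernel_def intro!: HomI)
  have "g = h"
    if g: "g \<in> Hom C (Cod C q) z" and h: "h \<in> Hom C (Cod C q) z" and gh: "g \<odot> q = h \<odot> q" for z g h
  proof -
    have "zero_arrow C ((h \<odot> q) \<odot> f)"
      using comp_zero_arrow_right[OF comp_hom[OF f q] h zero] comp_assoc[OF f q h] by simp
    then have "\<exists>!k. k \<in> Hom C (Cod C q) z \<and> k \<odot> q = h \<odot> q"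
      using q_coker comp_hom[OF q h] by (auto simp: is_cokernel_def)
    then show ?thesis
      using g h gh by blast
  qed
  then show ?thesis
    using HomD(1)[OF q] by (auto simp: epi_def)
qed

end

section \<open>Pullbacks as finite limits\<close>

text \<open>The shape \<open>0 \<rightarrow> 2 \<leftarrow> 1\<close>. The arrows \<open>0\<close>, \<open>1\<close>, \<open>2\<close> are the identities, and the arrows \<open>3\<close> and \<open>4\<close>
  are the two legs. In every composable pair at least one of the arrows is an identity, so the
  composite is the other one.\<close>

definition cospan_shape :: "(nat, nat) cat" where
  "cospan_shape = \<lparr>Obj = {0, 1, 2}, Arr = {0, 1, 2, 3, 4},
     Dom = (\<lambda>\<alpha>. if \<alpha> = 3 then 0 else if \<alpha> = 4 then 1 else \<alpha>),
     Cod = (\<lambda>\<alpha>. if \<alpha> = 3 \<or> \<alpha> = 4 then 2 else \<alpha>),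
     Id = (\<lambda>i. i), Comp = (\<lambda>\<beta> \<alpha>. if \<beta> \<le> 2 then \<alpha> else \<beta>)\<rparr>"

lemma cospan_shape_sel:
  "Obj cospan_shape = {0, 1, 2}"
  "Arr cospan_shape = {0, 1, 2, 3, 4}"
  "Id cospan_shape i = i"
  "Comp cospan_shape \<beta> \<alpha> = (if \<beta> \<le> 2 then \<alpha> else \<beta>)"
  by (simp_all add: cospan_shape_def)

lemma Hom_cospan_shape:
  "\<alpha> \<in> Hom cospan_shape i j \<longleftrightarrow>
     (\<alpha> = i \<and> j = i \<and> i \<in> {0, 1, 2}) \<or> (\<alpha> = 3 \<and> i = 0 \<and> j = 2) \<or> (\<alpha> = 4 \<and> i = 1 \<and> j = 2)"
  by (auto simp: Hom_def cospan_shape_def)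

lemma category_cospan_shape: "category cospan_shape"
proof
  show "Dom cospan_shape f \<in> Obj cospan_shape" if "f \<in> Arr cospan_shape" for f
    using that by (auto simp: cospan_shape_def)
  show "Cod cospan_shape f \<in> Obj cospan_shape" if "f \<in> Arr cospan_shape" for f
    using that by (auto simp: cospan_shape_def)
qed (auto simp: Hom_cospan_shape cospan_shape_sel)

lemma (in category) ex_pullback:
  assumes lims: "has_finite_limits C"
    and y: "y \<in> Hom C B D" and f: "f \<in> Hom C A D"
  obtains P p q where "p \<in> Hom C P B" "q \<in> Hom C P A" "is_pullback C p q y f"
proof -
  define F0 where "F0 i = (if i = 0 then B else if i = 1 then A else D)" for i :: nat
  define F1 where "F1 \<alpha> = (if \<alpha> = 3 then y else if \<alpha> = 4 then f else Id C (F0 \<alpha>))" for \<alpha> :: nat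
  have F0 [simp]: "F0 0 = B" "F0 (Suc 0) = A" "F0 2 = D"
    by (simp_all add: F0_def)
  have F1 [simp]: "F1 3 = y" "F1 4 = f" "i \<in> {0, 1, 2} \<Longrightarrow> F1 i = Id C (F0 i)" for i
    by (auto simp: F1_def)
  have F0_obj: "F0 i \<in> Obj C" for i
    using Hom_objs[OF y] Hom_objs[OF f] by (simp add: F0_def)
  have id: "Id C (F0 i) \<in> Hom C (F0 i) (F0 i)" for i
    using id_hom[OF F0_obj] .
  have id_idem: "Id C (F0 i) \<odot> Id C (F0 i) = Id C (F0 i)" for i
    using id_left[OF id] .
  note id_laws = id_idem[of 0] id_idem[of 1] id_idem[of 2] id_left[OF y] id_left[OF f] id_right[OF y] id_right[OF f]
  have "is_functor cospan_shape C F0 F1"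
    unfolding is_functor_def
  proof (intro conjI ballI)
    show "F1 \<alpha> \<in> Hom C (F0 i) (F0 j)" if "\<alpha> \<in> Hom cospan_shape i j" for i j \<alpha>
      using that id[of i] y f by (auto simp: Hom_cospan_shape)
    show "F1 (\<beta> \<odot>\<^bsub>cospan_shape\<^esub> \<alpha>) = F1 \<beta> \<odot> F1 \<alpha>"
      if "\<alpha> \<in> Hom cospan_shape i j" "\<beta> \<in> Hom cospan_shape j k" for i j k \<alpha> \<beta>
      using that by (auto simp: Hom_cospan_shape cospan_shape_sel id_laws[simplified])
  qed (auto simp: F0_obj cospan_shape_sel)
  then have "\<exists>P \<pi>. is_limit cospan_shape C F0 F1 P \<pi>"
    using lims category_cospan_shape
    by (simp add: has_finite_limits_def cospan_shape_sel)
  then obtain P \<pi> where lim: "is_limit cospan_shape C F0 F1 P \<pi>"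
    by blast
  have cone_iff: "is_cone cospan_shape C F0 F1 a \<rho> \<longleftrightarrow>
      \<rho> 0 \<in> Hom C a B \<and> \<rho> 1 \<in> Hom C a A \<and> \<rho> 2 \<in> Hom C a D \<and> y \<odot> \<rho> 0 = \<rho> 2 \<and> f \<odot> \<rho> 1 = \<rho> 2"
    (is "_ \<longleftrightarrow> ?cone \<rho>") for a \<rho>
  proof
    assume cone: "is_cone cospan_shape C F0 F1 a \<rho>"
    then have arrow: "F1 \<alpha> \<odot> \<rho> i = \<rho> j" if "\<alpha> \<in> Hom cospan_shape i j" for \<alpha> i j
      using that by (auto simp: is_cone_def Hom_cospan_shape cospan_shape_sel)
    have "y \<odot> \<rho> 0 = \<rho> 2" "f \<odot> \<rho> 1 = \<rho> 2"
      using arrow[of 3 0 2] arrow[of 4 1 2] by (simp_all add: Hom_cospan_shape)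
    then show "?cone \<rho>"
      using cone by (simp add: is_cone_def cospan_shape_sel)
  next
    assume \<rho>: "?cone \<rho>"
    then have leg: "\<rho> i \<in> Hom C a (F0 i)" if "i \<in> {0, 1, 2}" for i
      using that by auto
    have "F1 \<alpha> \<odot> \<rho> i = \<rho> j" if "\<alpha> \<in> Hom cospan_shape i j" for \<alpha> i j
      using that \<rho> id_left[OF leg, of i] by (auto simp: Hom_cospan_shape)
    then show "is_cone cospan_shape C F0 F1 a \<rho>"
      using leg \<rho> Hom_objs(1)[of "\<rho> 0" a B] by (simp add: is_cone_def cospan_shape_sel)
  qed
  have \<pi>: "\<pi> 0 \<in> Hom C P B" "\<pi> 1 \<in> Hom C P A" "y \<odot> \<pi> 0 = \<pi> 2" "f \<odot> \<pi> 1 = \<pi> 2"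
    using lim by (auto simp: is_limit_def cone_iff)
  have "\<exists>!h. h \<in> Hom C z P \<and> \<pi> 0 \<odot> h = u \<and> \<pi> 1 \<odot> h = v"
    if u: "u \<in> Hom C z B" and v: "v \<in> Hom C z A" and uv: "y \<odot> u = f \<odot> v" for z u v
  proof -
    define \<rho> where "\<rho> i = (if i = 0 then u else if i = 1 then v else y \<odot> u)" for i :: nat
    have "is_cone cospan_shape C F0 F1 z \<rho>"
      using u v uv comp_hom[OF u y] by (simp add: cone_iff \<rho>_def)
    then have "\<exists>!h. h \<in> Hom C z P \<and> (\<forall>i\<in>{0, 1, 2}. \<pi> i \<odot> h = \<rho> i)"
      using lim by (simp add: is_limit_def cospan_shape_sel)
    moreover have "(\<forall>i\<in>{0, 1, 2}. \<pi> i \<odot> h = \<rho> i) \<longleftrightarrow> \<pi> 0 \<odot> h = u \<and> \<pi> 1 \<odot> h = v"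
      if h: "h \<in> Hom C z P" for h
      using comp_assoc[OF h \<pi>(1) y] \<pi>(3) by (auto simp: \<rho>_def)
    ultimately show ?thesis
      by metis
  qed
  then have "is_pullback C (\<pi> 0) (\<pi> 1) y f"
    using \<pi> y f by (auto simp: is_pullback_def commutative_square_def Hom_def)
  then show thesis
    using that \<pi> by blast
qed

section \<open>Pullbacks that are pushouts\<close>

lemma (in pointed_category) ex_zero_arrow:
  assumes "a \<in> Obj C" "b \<in> Obj C"
  obtains g where "g \<in> Hom C a b" "zero_arrow C g"
proof -
  obtain z where z: "zero_object C z"
    using ex_zero_object by blast
  then obtain p i where p: "p \<in> Hom C a z" and i: "i \<in> Hom C z b"
    using assms unfolding zero_object_def by blast
  show thesis
    using that[OF comp_hom[OF p i] zero_arrowI[OF z p i]] .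
qed

text \<open>The arrow \<open>g\<close> with cokernel \<open>f\<close> lifts to \<open>X'\<close> as an arrow that \<open>f'\<close> kills. It therefore
  becomes zero after \<open>u f' = v x\<close>, which is what makes \<open>v\<close> factor through \<open>f\<close>.\<close>

lemma (in pointed_category) pullback_of_cokernel_pushout:
  assumes f': "f' \<in> Hom C X' Y'" and x: "x \<in> Hom C X' X"
    and y: "y \<in> Hom C Y' Y" and f: "f \<in> Hom C X Y"
    and pb: "is_pullback C f' x y f"
    and "normal_epi C f" and epi_f': "epi C f'"
  shows "is_pushout C f' x y f"
proof (rule pushout_if_factors[OF f' x y f _ epi_f' normal_epi_imp_epi[OF assms(6)]])
  show "y \<odot> f' = f \<odot> x"
    using pb by (simp add: is_pullback_def commutative_square_def)
  obtain g where coker: "is_cokernel C g f"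
    using assms(6) by (auto simp: normal_epi_def)
  define A where "A = Dom C g"
  have g: "g \<in> Hom C A X" and fg: "zero_arrow C (f \<odot> g)"
    using coker HomD[OF f] by (auto simp: is_cokernel_def A_def intro!: HomI)
  obtain n where n: "n \<in> Hom C A Y'" "zero_arrow C n"
    using ex_zero_arrow[OF Hom_objs(1)[OF g] Hom_objs(2)[OF f']] .
  have "y \<odot> n = f \<odot> g"
    using zero_arrow_unique[OF comp_hom[OF n(1) y] comp_hom[OF g f]]
      comp_zero_arrow_right[OF n(1) y n(2)] fg by blast
  then obtain g' where g': "g' \<in> Hom C A X'" "f' \<odot> g' = n" "x \<odot> g' = g"
    using is_pullbackD[OF pb f' x y f n(1) g] by blast
  fix z u v
  assume u: "u \<in> Hom C Y' z" and v: "v \<in> Hom C X z" and uv: "u \<odot> f' = v \<odot> x"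
  have "v \<odot> g = u \<odot> n"
    using comp_assoc[OF g'(1) x v] comp_assoc[OF g'(1) f' u] g' uv by simp
  then have "zero_arrow C (v \<odot> g)"
    using comp_zero_arrow_right[OF n(1) u n(2)] by simp
  then show "\<exists>h\<in>Hom C Y z. h \<odot> f = v"
    using coker v HomD[OF f] unfolding is_cokernel_def by metis
qed

text \<open>Pulling \<open>x\<close> back along one arrow \<open>s\<close> of the coequalized pair lifts both arrows: the lift of \<open>t\<close>
  comes from the given pullback, since \<open>f s = f t\<close>.\<close>

lemma (in prenormal_category) pullback_of_regular_epi_pushout:
  assumes f': "f' \<in> Hom C X' Y'" and x: "x \<in> Hom C X' X"
    and y: "y \<in> Hom C Y' Y" and f: "f \<in> Hom C X Y"
    and pb: "is_pullback C f' x y f"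
    and "normal_epi C x" "regular_epi C f" and epi_f': "epi C f'"
  shows "is_pushout C f' x y f"
proof -
  obtain s t where coeq: "is_coequalizer C s t f"
    using assms(7) by (auto simp: regular_epi_def)
  define A where "A = Dom C s"
  have s: "s \<in> Hom C A X" and t: "t \<in> Hom C A X" and fs_ft: "f \<odot> s = f \<odot> t"
    using coeq HomD[OF f] by (auto simp: is_coequalizer_def A_def intro!: HomI)
  have comm: "y \<odot> f' = f \<odot> x"
    using pb by (simp add: is_pullback_def commutative_square_def)
  obtain P p a where p: "p \<in> Hom C P A" and a: "a \<in> Hom C P X'" and pb': "is_pullback C p a s x"
    using ex_pullback[OF finite_limits s x] .
  have epi_p: "epi C p"
    using normal_epi_imp_epi[OF normal_epi_pullback_stable[OF pb' assms(6)]] .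
  have sp: "s \<odot> p = x \<odot> a"
    using pb' by (simp add: is_pullback_def commutative_square_def)
  have "y \<odot> (f' \<odot> a) = f \<odot> (x \<odot> a)"
    using comp_assoc[OF a f' y] comp_assoc[OF a x f] comm by simp
  also have "\<dots> = f \<odot> (t \<odot> p)"
    using sp comp_assoc[OF p s f] comp_assoc[OF p t f] fs_ft by simp
  finally obtain b where b: "b \<in> Hom C P X'" "f' \<odot> b = f' \<odot> a" "x \<odot> b = t \<odot> p"
    using is_pullbackD[OF pb f' x y f comp_hom[OF a f'] comp_hom[OF p t]] by blast
  show ?thesis
  proof (rule pushout_if_factors[OF f' x y f comm epi_f' coequalizer_epi[OF coeq]])
    fix z u v
    assume u: "u \<in> Hom C Y' z" and v: "v \<in> Hom C X z" and uv: "u \<odot> f' = v \<odot> x"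
    have "(v \<odot> s) \<odot> p = u \<odot> (f' \<odot> a)"
      using comp_assoc[OF p s v] sp comp_assoc[OF a x v] comp_assoc[OF a f' u] uv by simp
    also have "\<dots> = (v \<odot> t) \<odot> p"
      using comp_assoc[OF p t v] b comp_assoc[OF b(1) x v] comp_assoc[OF b(1) f' u] uv by simp
    finally have "v \<odot> s = v \<odot> t"
      using epiD[OF epi_p p comp_hom[OF s v] comp_hom[OF t v]] by blast
    then show "\<exists>h\<in>Hom C Y z. h \<odot> f = v"
      using coeq v HomD[OF f] unfolding is_coequalizer_def by metis
  qed
qed

theorem proposition2p5:
  fixes C :: "('o, 'm) cat"
    and X' Y' X Y :: 'o
    and f' x y f :: 'm
  assumes "prenormal_category C"
    and "f' \<in> Hom C X' Y'" and "x \<in> Hom C X' X"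
    and "y \<in> Hom C Y' Y" and "f \<in> Hom C X Y"
    and "is_pullback C f' x y f"
    and "normal_epi C f \<or> (normal_epi C x \<and> regular_epi C f \<and> epi C f')"
  shows "is_pushout C f' x y f"
proof -
  interpret prenormal_category C
    by (fact assms(1))
  show ?thesis
    using assms(7)
  proof
    assume f: "normal_epi C f"
    then have "epi C f'"
      using normal_epi_imp_epi normal_epi_pullback_stable[OF assms(6)] by blast
    then show ?thesis
      using pullback_of_cokernel_pushout[OF assms(2-6) f] by blast
  next
    assume "normal_epi C x \<and> regular_epi C f \<and> epi C f'"
    then show ?thesis
      using pullback_of_regular_epi_pushout[OF assms(2-6)] by blast
  qed
qed

end
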